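(* Let $k\geq 2$, and let $A_1,\ldots,A_k$ be DFAs over a common alphabet, where $A_i$ has $n_i$ states, of which $f_i$ are final states, with $0<f_i<n_i$ for $1\leq i\leq k$. Then there exists a DFA with $$n_1 2^{n_2+\cdots+n_k}-D-\sum_{i=1}^{k-1}E_i$$ states that accepts the catenation $L(A_1)L(A_2)\cdots L(A_k)$, where $D$ and $E_i$ are defined as follows. First, $$D=n_1\sum_{t=2}^{k-1}\Bigl(\prod_{j=2}^{t-1}(2^{n_j}-1)\Bigr)\bigl(2^{n_{t+1}+\cdots+n_k}-1\bigr)$$ (with $D=0$ if $k=2$). Put $N_{k+1}=1$ and $N_j=1+(2^{n_j}-1)N_{j+1}$ for $3\le j\le k$ (so $N_k=2^{n_k}$ when $k\geq 3$), and $T_j=1+(2^{n_j-1}-1)N_{j+1}$ for $2\leq j\leq k$. Put $w_1(0)=n_1-f_1$, $w_1(1)=f_1$, and for $2\le j\le k-1$ $$w_j(0,0)=2^{n_j-f_j}-1,\quad w_j(0,1)=(2^{f_j}-1)2^{n_j-f_j},$$ $$w_j(1,0)=2^{n_j-f_j-1},\quad w_j(1,1)=(2^{f_j}-1)2^{n_j-f_j-1}.$$ Then, for $1\leq i\leq k-1$, $$E_i=T_{i+1}\sum_{\substack{(\epsilon_1,\ldots,\epsilon_i)\in\{0,1\}^i\\ \epsilon_i=1}} w_1(\epsilon_1)\prod_{j=2}^{i}w_j(\epsilon_{j-1},\epsilon_j).$$ (For example $E_1=f_1T_2$ and $E_2=\bigl((n_1-f_1)(2^{f_2}-1)2^{n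_2-f_2}+f_1(2^{f_2}-1)2^{n_2-f_2-1}\bigr)T_3$.)
   Context: A DFA is a tuple $(Q,\Sigma,\delta,s,F)$ with $Q$ a finite nonempty set of states, $\Sigma$ a finite nonempty input alphabet, $\delta:Q\times\Sigma\to Q$ the transition function, $s\in Q$ the initial state and $F\subseteq Q$ the set of final states. All DFAs are complete, i.e. $\delta$ is a total function (states are not required to be reachable). $L(A)$ is the language accepted by $A$. The catenation of languages is $L_1L_2=\{uv\mid u\in L_1,v\in L_2\}$. Empty sums are $0$ and empty products are $1$. *)

theory Defs
  imports Main "HOL-Library.FuncSet"
begin

record ('q, 'a) dfa =
  states :: "'q set"
  alphabet :: "'a set"
  trans_fun :: "'q \<Rightarrow> 'a \<Rightarrow> 'q"
  start :: 'q
  finals :: "'q set"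

text \<open>Completeness of the automaton is the closure condition on the transition function.
  Its values outside states times alphabet are irrelevant.\<close>

definition is_dfa :: "('q, 'a) dfa \<Rightarrow> bool" where
  "is_dfa A \<longleftrightarrow>
     finite (states A) \<and> states A \<noteq> {} \<and>
     finite (alphabet A) \<and> alphabet A \<noteq> {} \<and>
     (\<forall>q\<in>states A. \<forall>a\<in>alphabet A. trans_fun A q a \<in> states A) \<and>
     start A \<in> states A \<and>
     finals A \<subseteq> states A"

definition dfa_lang :: "('q, 'a) dfa \<Rightarrow> 'a list set" where
  "dfa_lang A = {w \<in> lists (alphabet A). foldl (trans_fun A) (start A) w \<in> finals A}"

definition catenation :: "'a list set \<Rightarrow> 'a list set \<Rightarrow> 'a list set" where
  "catenation L1 L2 = {u @ v | u v. u \<in> L1 \<and> v \<in> L2}"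

definition catenation_list :: "'a list set list \<Rightarrow> 'a list set" where
  "catenation_list Ls = foldr catenation Ls {[]}"

text \<open>The quantities below are integers, so that only the exponents use the truncated
  subtraction of natural numbers; those are exact when \<open>0 < f j < n j\<close>.\<close>

definition D_term :: "nat \<Rightarrow> (nat \<Rightarrow> nat) \<Rightarrow> int" where
  "D_term k n =
     int (n 1) * (\<Sum>t\<in>{2..<k}. (\<Prod>j\<in>{2..<t}. (2 ^ n j - 1)) * (2 ^ (\<Sum>j\<in>{t+1..k}. n j) - 1))"

text \<open>The recursion for \<open>N_term\<close> runs downwards from index \<open>k + 1\<close>; only the indices
  \<open>3, \<dots>, k + 1\<close> enter the other definitions.\<close>

function N_term :: "nat \<Rightarrow> (nat \<Rightarrow> nat) \<Rightarrow> nat \<Rightarrow> int" where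
  "N_term k n j = (if k < j then 1 else 1 + (2 ^ n j - 1) * N_term k n (j + 1))"
  by pat_completeness auto
termination by (relation "measure (\<lambda>(k, n, j). Suc k - j)") auto

declare N_term.simps [simp del]

definition T_term :: "nat \<Rightarrow> (nat \<Rightarrow> nat) \<Rightarrow> nat \<Rightarrow> int" where
  "T_term k n j = 1 + (2 ^ (n j - 1) - 1) * N_term k n (j + 1)"

definition w_first :: "(nat \<Rightarrow> nat) \<Rightarrow> (nat \<Rightarrow> nat) \<Rightarrow> nat \<Rightarrow> int" where
  "w_first n f b = (if b = 0 then int (n 1) - int (f 1) else int (f 1))"

definition w_next :: "(nat \<Rightarrow> nat) \<Rightarrow> (nat \<Rightarrow> nat) \<Rightarrow> nat \<Rightarrow> nat \<Rightarrow> nat \<Rightarrow> int" where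
  "w_next n f j a b =
     (if a = 0
      then (if b = 0 then 2 ^ (n j - f j) - 1 else (2 ^ f j - 1) * 2 ^ (n j - f j))
      else (if b = 0 then 2 ^ (n j - f j - 1) else (2 ^ f j - 1) * 2 ^ (n j - f j - 1)))"

definition E_term :: "nat \<Rightarrow> (nat \<Rightarrow> nat) \<Rightarrow> (nat \<Rightarrow> nat) \<Rightarrow> nat \<Rightarrow> int" where
  "E_term k n f i =
     T_term k n (i + 1) *
     (\<Sum>e\<in>{e \<in> {1..i} \<rightarrow>\<^sub>E {0, 1}. e i = 1}.
        w_first n f (e 1) * (\<Prod>j\<in>{2..i}. w_next n f j (e (j - 1)) (e j)))"

end

theory Submission
  imports Defs
begin

text \<open>Reading \<open>w\<close>, track for each \<open>j\<close> the set \<open>R\<^sub>j(w)\<close> of states of \<open>A\<^sub>j\<close> reached on a suffix of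
  \<open>w\<close> whose complementary prefix lies in \<open>L(A\<^sub>1)\<dots>L(A\<^sub>j\<^sub>-\<^sub>1)\<close>. Here \<open>R\<^sub>1(w)\<close> is a singleton, emptiness
  of \<open>R\<^sub>j\<close> propagates to \<open>R\<^sub>j\<^sub>+\<^sub>1\<close>, and \<open>R\<^sub>j\<^sub>+\<^sub>1\<close> contains the initial state whenever \<open>R\<^sub>j\<close> meets the
  final states. The tuples with these properties are counted from the right by a two-valued
  recursion \<open>V\<^sub>j(\<epsilon>)\<close>, where \<open>\<epsilon>\<close> records whether \<open>R\<^sub>j\<^sub>-\<^sub>1\<close> contains a final state. The stated number is
  exactly \<open>w\<^sub>1(0) V\<^sub>2(0) + w\<^sub>1(1) V\<^sub>2(1)\<close>; it is the true count if no initial state is final, and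
  an upper bound otherwise, because \<open>V\<^sub>j(1) \<le> V\<^sub>j(0)\<close>. Unreachable states make up the
  difference.\<close>

section \<open>The counting recursion\<close>

text \<open>The summand 1 for \<open>b = 0\<close> is the tail with all entries empty; for
  \<open>b = 1\<close> the forced initial state excludes it. The \<open>w_next\<close> weights count
  the nonempty entries \<open>j\<close> that avoid or meet the final states, taking a forced initial
  state as nonfinal. Beyond \<open>k\<close> only the empty tail remains.\<close>

function V_count :: "nat \<Rightarrow> (nat \<Rightarrow> nat) \<Rightarrow> (nat \<Rightarrow> nat) \<Rightarrow> nat \<Rightarrow> nat \<Rightarrow> int" where
  "V_count k n f j b =
     (if k < j then 1
      else (if b = 0 then 1 else 0) + w_next n f j b 0 * V_count k n f (j + 1) 0
        + w_next n f j b 1 * V_count k n f (j + 1) 1)"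
  by pat_completeness auto
termination by (relation "measure (\<lambda>(k, n, f, j, b). Suc k - j)") auto

declare V_count.simps [simp del]

text \<open>The inner sum of \<open>E_term\<close> with its last flag left free: a recursion in
  \<open>i\<close> needs both values.\<close>

definition prefix_weight :: "(nat \<Rightarrow> nat) \<Rightarrow> (nat \<Rightarrow> nat) \<Rightarrow> nat \<Rightarrow> nat \<Rightarrow> int" where
  "prefix_weight n f i b =
     (\<Sum>e\<in>{e \<in> {1..i} \<rightarrow>\<^sub>E {0, 1}. e i = b}.
        w_first n f (e 1) * (\<Prod>j\<in>{2..i}. w_next n f j (e (j - 1)) (e j)))"

lemma E_term_eq: "E_term k n f i = T_term k n (i + 1) * prefix_weight n f i 1"
  by (simp add: E_term_def prefix_weight_def)

lemma w_next_0_sum: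
  assumes "f j \<le> n j"
  shows "w_next n f j 0 0 + w_next n f j 0 1 = 2 ^ n j - 1"
proof -
  have "(2::int) ^ n j = 2 ^ f j * 2 ^ (n j - f j)"
    using assms by (simp flip: power_add)
  then show ?thesis by (simp add: w_next_def algebra_simps)
qed

lemma w_next_1_sum:
  assumes "f j < n j"
  shows "w_next n f j 1 0 + w_next n f j 1 1 = 2 ^ (n j - 1)"
proof -
  have "(2::int) ^ (n j - 1) = 2 ^ f j * 2 ^ (n j - f j - 1)"
    using assms by (simp flip: power_add)
  then show ?thesis by (simp add: w_next_def algebra_simps)
qed

lemma w_next_nonneg: "0 \<le> w_next n f j a b"
  by (simp add: w_next_def)

text \<open>For \<open>b = 0\<close> this is 2^m \<le> 2^(m+1) - 1, where \<open>f j < n j\<close>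
  supplies \<open>m\<close>.\<close>

lemma w_next_mono:
  assumes "f j < n j"
  shows "w_next n f j 1 b \<le> w_next n f j 0 b"
proof -
  obtain m where "n j - f j = Suc m"
    using assms by (metis Suc_diff_Suc)
  moreover have "(1::int) \<le> 2 ^ m" by simp
  ultimately show ?thesis
    by (auto simp: w_next_def mult_left_mono)
qed

lemma V_count_nonneg: "0 \<le> V_count k n f j b"
proof (induction k n f j b rule: V_count.induct)
  case (1 k n f j b)
  then show ?case
    by (subst V_count.simps) (auto intro!: add_nonneg_nonneg mult_nonneg_nonneg w_next_nonneg)
qed

lemma V_count_mono:
  assumes "j \<le> k \<Longrightarrow> f j < n j"
  shows "V_count k n f j 1 \<le> V_count k n f j 0"
proof (cases "k < j")
  case False
  then have "w_next n f j 1 b \<le> w_next n f j 0 b" for b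
    using assms by (intro w_next_mono) auto
  then have "w_next n f j 1 b * V_count k n f (j + 1) c \<le> w_next n f j 0 b * V_count k n f (j + 1) c" for b c
    by (intro mult_right_mono V_count_nonneg)
  from add_mono[OF this[of 0 0] this[of 1 1]] False show ?thesis
    by (simp add: V_count.simps[of k n f j])
qed (simp add: V_count.simps)

lemma prefix_weight_1: "b \<in> {0, 1} \<Longrightarrow> prefix_weight n f 1 b = w_first n f b"
proof -
  assume "b \<in> {0, 1}"
  then have "{e \<in> {1..1} \<rightarrow>\<^sub>E {0, 1}. e 1 = b} = {\<lambda>x\<in>{1..1::nat}. b}"
    by (auto simp: PiE_iff extensional_def fun_eq_iff)
  then show ?thesis by (simp add: prefix_weight_def)
qed

text \<open>A transfer-matrix step: split the flag sequences by their value at \<open>i\<close>; the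
  new factor depends on the last two flags only.\<close>

lemma prefix_weight_Suc:
  assumes "1 \<le> i" "b \<in> {0, 1}"
  shows "prefix_weight n f (Suc i) b =
    prefix_weight n f i 0 * w_next n f (Suc i) 0 b + prefix_weight n f i 1 * w_next n f (Suc i) 1 b"
proof -
  let ?E = "\<lambda>i b. {e \<in> {1..i} \<rightarrow>\<^sub>E {0, 1::nat}. e i = b}"
  let ?g = "\<lambda>i e. w_first n f (e 1) * (\<Prod>j\<in>{2..i}. w_next n f j (e (j - 1)) (e j))"
  have fin: "finite (?E i a)" for a
    by (rule finite_subset[of _ "{1..i} \<rightarrow>\<^sub>E {0, 1}"]) (auto intro: finite_PiE)
  \<comment> \<open>The flag at \<open>Suc i\<close> is fixed to \<open>b\<close>, so deleting it is
    a bijection; deletion means resetting to \<open>undefined\<close>, as the functions are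
    extensional.\<close>
  have "prefix_weight n f (Suc i) b = (\<Sum>e\<in>{1..i} \<rightarrow>\<^sub>E {0, 1}. ?g i e * w_next n f (Suc i) (e i) b)"
    unfolding prefix_weight_def
  proof (rule sum.reindex_bij_witness[where i = "\<lambda>e. e(Suc i := b)" and j = "\<lambda>e. e(Suc i := undefined)"])
    fix e assume e: "e \<in> ?E (Suc i) b"
    show "(e(Suc i := undefined))(Suc i := b) = e" using e by auto
    show "e(Suc i := undefined) \<in> {1..i} \<rightarrow>\<^sub>E {0, 1}"
      using e by (auto simp: PiE_iff extensional_def)
    have "(\<Prod>j\<in>{2..i}. w_next n f j ((e(Suc i := undefined)) (j - 1)) ((e(Suc i := undefined)) j))
        = (\<Prod>j\<in>{2..i}. w_next n f j (e (j - 1)) (e j))"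
      by (rule prod.cong) auto
    then show "?g i (e(Suc i := undefined)) * w_next n f (Suc i) ((e(Suc i := undefined)) i) b
        = ?g (Suc i) e"
      using e assms by (simp add: prod.nat_ivl_Suc')
  next
    fix e assume e: "e \<in> {1..i} \<rightarrow>\<^sub>E {0, 1::nat}"
    show "(e(Suc i := b))(Suc i := undefined) = e"
      using e by (auto simp: PiE_iff extensional_def)
    show "e(Suc i := b) \<in> ?E (Suc i) b"
      using e assms by (auto simp: PiE_iff extensional_def)
  qed
  also have "{1..i} \<rightarrow>\<^sub>E {0, 1} = ?E i 0 \<union> ?E i 1"
  proof (intro equalityI subsetI)
    fix e assume e: "e \<in> {1..i} \<rightarrow>\<^sub>E {0, 1::nat}"
    moreover have "e i \<in> {0, 1}" using PiE_mem[OF e, of i] assms by simp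
    ultimately show "e \<in> ?E i 0 \<union> ?E i 1" by blast
  qed blast
  also have "(\<Sum>e\<in>?E i 0 \<union> ?E i 1. ?g i e * w_next n f (Suc i) (e i) b)
      = (\<Sum>e\<in>?E i 0. ?g i e * w_next n f (Suc i) (e i) b) + (\<Sum>e\<in>?E i 1. ?g i e * w_next n f (Suc i) (e i) b)"
    using fin by (intro sum.union_disjoint) auto
  also have "\<dots> = prefix_weight n f i 0 * w_next n f (Suc i) 0 b + prefix_weight n f i 1 * w_next n f (Suc i) 1 b"
    unfolding prefix_weight_def sum_distrib_right by (intro arg_cong2[of _ _ _ _ "(+)"] sum.cong) auto
  finally show ?thesis .
qed

section \<open>Telescoping the corrections D and E\<close>

text \<open>\<open>N_term k n m\<close> counts the tuples of subsets at indices \<open>m\<close> to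
  \<open>k\<close> in which emptiness propagates to the right. The excluded tuples either have an
  empty entry at \<open>m\<close> and a nonempty one later, or a nonempty entry at \<open>m\<close>
  and an excluded tail; unfold this up to \<open>m\<close>.\<close>

lemma N_term_telescope:
  assumes "2 \<le> m" "m \<le> k + 1"
  shows "2 ^ (\<Sum>j\<in>{2..k}. n j) - N_term k n 2 =
    (\<Sum>t\<in>{2..<m}. (\<Prod>j\<in>{2..<t}. (2 ^ n j - 1)) * (2 ^ (\<Sum>j\<in>{t+1..k}. n j) - 1))
     + (\<Prod>j\<in>{2..<m}. (2 ^ n j - 1)) * (2 ^ (\<Sum>j\<in>{m..k}. n j) - N_term k n m)"
  using assms
proof (induction m rule: dec_induct)
  case (step m)
  have "(2::int) ^ (\<Sum>j\<in>{m..k}. n j) = 2 ^ n m * 2 ^ (\<Sum>j\<in>{Suc m..k}. n j)"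
    using step.prems by (simp add: sum.atLeast_Suc_atMost power_add)
  moreover have "N_term k n m = 1 + (2 ^ n m - 1) * N_term k n (Suc m)"
    using step.prems by (simp add: N_term.simps[of k n m])
  ultimately have "(2::int) ^ (\<Sum>j\<in>{m..k}. n j) - N_term k n m =
      2 ^ (\<Sum>j\<in>{m+1..k}. n j) - 1 + (2 ^ n m - 1) * (2 ^ (\<Sum>j\<in>{Suc m..k}. n j) - N_term k n (Suc m))"
    by (simp add: algebra_simps)
  moreover have "2 ^ (\<Sum>j\<in>{2..k}. n j) - N_term k n 2 =
    (\<Sum>t\<in>{2..<m}. (\<Prod>j\<in>{2..<t}. (2 ^ n j - 1)) * (2 ^ (\<Sum>j\<in>{t+1..k}. n j) - 1))
     + (\<Prod>j\<in>{2..<m}. (2 ^ n j - 1)) * (2 ^ (\<Sum>j\<in>{m..k}. n j) - N_term k n m)"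
    using step by simp
  ultimately show ?case
    using step.hyps(1) by (simp only: sum.atLeastLessThan_Suc prod.atLeastLessThan_Suc distrib_left mult.assoc add.assoc)
qed simp

lemma N_term_2:
  assumes "2 \<le> k"
  shows "int (n 1) * N_term k n 2 = int (n 1) * 2 ^ (\<Sum>j\<in>{2..k}. n j) - D_term k n"
proof -
  \<comment> \<open>At \<open>m = k\<close> the remainder vanishes, since a single entry cannot
    violate propagation.\<close>
  have "2 ^ (\<Sum>j\<in>{2..k}. n j) - N_term k n 2 =
    (\<Sum>t\<in>{2..<k}. (\<Prod>j\<in>{2..<t}. (2 ^ n j - 1)) * (2 ^ (\<Sum>j\<in>{t+1..k}. n j) - 1))"
    using N_term_telescope[of k k n] assms
    by (simp add: N_term.simps[of k n k] N_term.simps[of k n "Suc k"])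
  then show ?thesis
    unfolding D_term_def by (metis (no_types, lifting) diff_diff_eq2 diff_add_cancel int_distrib(4) add_diff_cancel_left')
qed

text \<open>For nonfinal initial states, \<open>N_term\<close> minus \<open>V_count\<close> counts
  the tails that respect emptiness but miss a forced initial state. With nothing forced at
  \<open>j\<close>, the miss occurs later.\<close>

lemma V_deficit_0:
  assumes "j \<le> k" "f j < n j"
  shows "N_term k n j - V_count k n f j 0 =
    w_next n f j 0 0 * (N_term k n (j + 1) - V_count k n f (j + 1) 0)
    + w_next n f j 0 1 * (N_term k n (j + 1) - V_count k n f (j + 1) 1)"
proof -
  have "N_term k n j = 1 + (w_next n f j 0 0 + w_next n f j 0 1) * N_term k n (j + 1)"
    using assms unfolding w_next_0_sum[of f j n, OF less_imp_le[OF assms(2)]]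
    by (simp add: N_term.simps[of k n j])
  moreover have "V_count k n f j 0 = 1 + w_next n f j 0 0 * V_count k n f (j + 1) 0
        + w_next n f j 0 1 * V_count k n f (j + 1) 1"
    using assms by (simp add: V_count.simps[of k n f j])
  ultimately show ?thesis by (simp add: algebra_simps)
qed

text \<open>With the initial state forced at \<open>j\<close>, the new contribution
  \<open>T_term k n j\<close> counts the tails whose entry \<open>j\<close> lacks it: the empty
  tail, and those with one of the 2^(n_j - 1) - 1 nonempty sets without it.\<close>

lemma V_deficit_1:
  assumes "j \<le> k" "f j < n j"
  shows "N_term k n j - V_count k n f j 1 = T_term k n j
    + w_next n f j 1 0 * (N_term k n (j + 1) - V_count k n f (j + 1) 0)
    + w_next n f j 1 1 * (N_term k n (j + 1) - V_count k n f (j + 1) 1)"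
proof -
  have "(2::int) ^ n j = 2 * 2 ^ (n j - 1)"
    using assms by (metis power_Suc Suc_pred' less_zeroE neq0_conv)
  then have "N_term k n j = T_term k n j + (w_next n f j 1 0 + w_next n f j 1 1) * N_term k n (j + 1)"
    unfolding w_next_1_sum[of f j n, OF assms(2)]
    using assms by (simp add: N_term.simps[of k n j] T_term_def algebra_simps)
  moreover have "V_count k n f j 1 = w_next n f j 1 0 * V_count k n f (j + 1) 0
        + w_next n f j 1 1 * V_count k n f (j + 1) 1"
    using assms by (simp add: V_count.simps[of k n f j])
  ultimately show ?thesis by (simp add: algebra_simps)
qed

text \<open>Each unfolding of the deficits at index \<open>m + 1\<close> releases
  \<open>T_term k n (m + 1)\<close> with weight \<open>prefix_weight n f m 1\<close>, which is
  \<open>E_term k n f m\<close>. For nonfinal initial states, it counts the tuples whose first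
  missing forced initial state is at \<open>m + 1\<close>.\<close>

lemma E_term_telescope:
  assumes "\<And>i. i \<in> {1..k} \<Longrightarrow> f i < n i" "1 \<le> m" "m \<le> k"
  shows "w_first n f 0 * (N_term k n 2 - V_count k n f 2 0) + w_first n f 1 * (N_term k n 2 - V_count k n f 2 1)
    = (\<Sum>i\<in>{1..<m}. E_term k n f i)
      + prefix_weight n f m 0 * (N_term k n (m + 1) - V_count k n f (m + 1) 0)
      + prefix_weight n f m 1 * (N_term k n (m + 1) - V_count k n f (m + 1) 1)"
  using assms(2,3)
proof (induction m rule: dec_induct)
  case base
  have "prefix_weight n f 1 0 = w_first n f 0" "prefix_weight n f 1 1 = w_first n f 1"
    by (rule prefix_weight_1; simp)+
  then show ?case by (simp add: numeral_2_eq_2)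
next
  case (step m)
  let ?X = "\<lambda>j b. N_term k n j - V_count k n f j b"
  have lt: "m + 1 \<le> k" "f (m + 1) < n (m + 1)"
    using step.prems assms(1) by auto
  have E: "(\<Sum>i\<in>{1..<Suc m}. E_term k n f i) =
      (\<Sum>i\<in>{1..<m}. E_term k n f i) + T_term k n (m + 1) * prefix_weight n f m 1"
    using step.hyps by (simp add: E_term_eq)
  have P: "prefix_weight n f (Suc m) b =
    prefix_weight n f m 0 * w_next n f (m + 1) 0 b + prefix_weight n f m 1 * w_next n f (m + 1) 1 b"
    if "b \<in> {0, 1}" for b
    using prefix_weight_Suc[OF step.hyps(1) that] by simp
  have "w_first n f 0 * ?X 2 0 + w_first n f 1 * ?X 2 1 = (\<Sum>i\<in>{1..<m}. E_term k n f i)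
      + prefix_weight n f m 0 * ?X (m + 1) 0 + prefix_weight n f m 1 * ?X (m + 1) 1"
    using step by simp
  also have "\<dots> = (\<Sum>i\<in>{1..<m}. E_term k n f i) + T_term k n (m + 1) * prefix_weight n f m 1
      + prefix_weight n f (Suc m) 0 * ?X (m + 1 + 1) 0 + prefix_weight n f (Suc m) 1 * ?X (m + 1 + 1) 1"
    unfolding V_deficit_0[of "m + 1" k f n, OF lt] V_deficit_1[of "m + 1" k f n, OF lt] P[OF insertI1] P[OF insertI2[OF insertI1]]
    by (simp only: algebra_simps)
  finally show ?case
    unfolding E by simp
qed

lemma V_count_2:
  assumes "2 \<le> k" "\<And>i. i \<in> {1..k} \<Longrightarrow> f i < n i"
  shows "w_first n f 0 * V_count k n f 2 0 + w_first n f 1 * V_count k n f 2 1 =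
    int (n 1) * 2 ^ (\<Sum>j\<in>{2..k}. n j) - D_term k n - (\<Sum>i\<in>{1..k-1}. E_term k n f i)"
proof -
  have "{1..k-1} = {1..<k}" using assms(1) by auto
  \<comment> \<open>Take \<open>m = k\<close>: at index \<open>k + 1\<close> both counts are 1, so
    no deficit is left.\<close>
  moreover have "w_first n f 0 * (N_term k n 2 - V_count k n f 2 0)
      + w_first n f 1 * (N_term k n 2 - V_count k n f 2 1) = (\<Sum>i\<in>{1..<k}. E_term k n f i)"
    using E_term_telescope[of k f n k] assms
    by (simp add: N_term.simps[of k n "Suc k"] V_count.simps[of k n f "Suc k"])
  moreover have "int (n 1) = w_first n f 0 + w_first n f 1"
    by (simp add: w_first_def)
  ultimately show ?thesis
    using N_term_2[OF assms(1), of n] by (simp add: algebra_simps)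
qed

section \<open>Counting subsets\<close>

lemma card_Pow_avoiding:
  assumes "finite Q" "F \<subseteq> Q"
  shows "int (card {S \<in> Pow Q - {{}}. S \<inter> F = {}}) = 2 ^ (card Q - card F) - 1"
proof -
  have "{S \<in> Pow Q - {{}}. S \<inter> F = {}} = Pow (Q - F) - {{}}" by auto
  moreover have "card (Q - F) = card Q - card F"
    using assms by (meson card_Diff_subset finite_subset)
  ultimately show ?thesis
    using assms by (simp add: card_Diff_subset card_Pow of_nat_diff)
qed

lemma card_Pow_containing:
  assumes "finite Q" "s \<in> Q"
  shows "card {S \<in> Pow Q. s \<in> S} = 2 ^ (card Q - 1)"
proof -
  have "{S \<in> Pow Q. s \<in> S} = insert s ` Pow (Q - {s})"
  proof (intro equalityI subsetI)
    fix S assume "S \<in> {S \<in> Pow Q. s \<in> S}"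
    then have "S = insert s (S - {s})" "S - {s} \<in> Pow (Q - {s})" by auto
    then show "S \<in> insert s ` Pow (Q - {s})" by blast
  qed (use assms in auto)
  moreover have "inj_on (insert s) (Pow (Q - {s}))"
    by (rule inj_onI) blast
  ultimately show ?thesis
    using assms by (simp add: card_image card_Pow)
qed

text \<open>Equality holds for \<open>s\<close> outside \<open>F\<close>; for \<open>s\<close> in
  \<open>F\<close> there are no such sets.\<close>

lemma card_Pow_containing_avoiding:
  assumes "finite Q" "F \<subseteq> Q" "s \<in> Q"
  shows "card {S \<in> Pow Q. s \<in> S \<and> S \<inter> F = {}} \<le> 2 ^ (card Q - card F - 1)"
proof (cases "s \<in> F")
  case True
  then have "{S \<in> Pow Q. s \<in> S \<and> S \<inter> F = {}} = {}" by auto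
  then show ?thesis by (simp only: card.empty zero_le)
next
  case False
  have "{S \<in> Pow Q. s \<in> S \<and> S \<inter> F = {}} = {S \<in> Pow (Q - F). s \<in> S}" by auto
  moreover have "card (Q - F) = card Q - card F"
    using assms by (meson card_Diff_subset finite_subset)
  ultimately show ?thesis
    using card_Pow_containing[of "Q - F" s] assms False by simp
qed

text \<open>Write each summand as \<open>y\<close>, plus \<open>x - y\<close> where \<open>P\<close>
  fails. As \<open>x - y\<close> is nonnegative, an upper bound on the number of failures suffices,
  while the total must be exact.\<close>

lemma sum_if_le:
  fixes x y :: int
  assumes "finite B" "int (card B) = a + b" "int (card {S \<in> B. \<not> P S}) \<le> a" "y \<le> x"
  shows "(\<Sum>S\<in>B. if P S then y else x) \<le> a * x + b * y"
proof -
  let ?M = "{S \<in> B. \<not> P S}"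
  have "(\<Sum>S\<in>B. if P S then y else x) = (\<Sum>S\<in>B. y + (if \<not> P S then x - y else 0))"
    by (rule sum.cong) auto
  also have "\<dots> = int (card B) * y + int (card ?M) * (x - y)"
    using assms(1) by (simp only: sum.distrib sum.inter_filter[symmetric] sum_constant)
  also have "\<dots> \<le> int (card B) * y + a * (x - y)"
    using assms by (intro add_left_mono mult_right_mono) auto
  also have "\<dots> = a * x + b * y"
    using assms(2) by (simp add: algebra_simps)
  finally show ?thesis .
qed

section \<open>Automata from right congruences\<close>

text \<open>The values of \<open>R\<close> act as states, numbered below \<open>m\<close>. Numbers
  that no word attains stay as unreachable states, so the state count is \<open>m\<close> exactly
  and not merely at most \<open>m\<close>.\<close>

lemma dfa_of_right_congruence:
  fixes R :: "'a list \<Rightarrow> 'b"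
  assumes "finite \<Sigma>" "\<Sigma> \<noteq> {}" "L \<subseteq> lists \<Sigma>"
    and fin: "finite X" and R: "R ` lists \<Sigma> \<subseteq> X" and card: "card X \<le> m"
    and cong: "\<And>u v a. u \<in> lists \<Sigma> \<Longrightarrow> v \<in> lists \<Sigma> \<Longrightarrow> a \<in> \<Sigma> \<Longrightarrow> R u = R v \<Longrightarrow> R (u @ [a]) = R (v @ [a])"
    and sat: "\<And>u v. u \<in> lists \<Sigma> \<Longrightarrow> v \<in> lists \<Sigma> \<Longrightarrow> R u = R v \<Longrightarrow> u \<in> L \<Longrightarrow> v \<in> L"
  shows "\<exists>B :: (nat, 'a) dfa. is_dfa B \<and> alphabet B = \<Sigma> \<and> card (states B) = m \<and> dfa_lang B = L"
proof -
  obtain g where g: "inj_on g X" "g ` X \<subseteq> {..<m}"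
    using card_le_inj[of X "{..<m}"] fin card by auto
  have gR: "g (R u) = g (R v) \<longleftrightarrow> R u = R v" if "u \<in> lists \<Sigma>" "v \<in> lists \<Sigma>" for u v
    using inj_on_eq_iff[OF g(1), of "R u" "R v"] that R by blast
  define rep where "rep q = (SOME w. w \<in> lists \<Sigma> \<and> g (R w) = q)" for q
  have rep: "rep (g (R w)) \<in> lists \<Sigma> \<and> R (rep (g (R w))) = R w" if "w \<in> lists \<Sigma>" for w
  proof -
    have "rep (g (R w)) \<in> lists \<Sigma> \<and> g (R (rep (g (R w)))) = g (R w)"
      unfolding rep_def by (rule someI[of _ w]) (use that in simp)
    then show ?thesis using gR that by blast
  qed
  \<comment> \<open>Unattained numbers loop to themselves, which keeps the transition function total
    on the states.\<close>
  define tr where "tr q a = (if q \<in> g ` R ` lists \<Sigma> then g (R (rep q @ [a])) else q)" for q a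
  define B where "B = \<lparr>states = {..<m}, alphabet = \<Sigma>, trans_fun = tr, start = g (R []), finals = g ` R ` L\<rparr>"
  have in_m: "g (R w) < m" if "w \<in> lists \<Sigma>" for w
    using that g(2) R by blast
  have tr: "tr (g (R u)) a = g (R (u @ [a]))" if "u \<in> lists \<Sigma>" "a \<in> \<Sigma>" for u a
    using that rep[OF that(1)] cong by (metis tr_def imageI)
  have fold: "foldl tr (g (R [])) w = g (R w)" if "w \<in> lists \<Sigma>" for w
    using that by (induction w rule: rev_induct) (auto simp: tr)
  have "is_dfa B"
  proof -
    have "tr q a < m" if "q < m" "a \<in> \<Sigma>" for q a
    proof (cases "q \<in> g ` R ` lists \<Sigma>")
      case True
      then obtain w where "w \<in> lists \<Sigma>" "q = g (R w)" by auto
      then show ?thesis using that tr[of w a] in_m[of "w @ [a]"] by simp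
    qed (use that in \<open>simp add: tr_def\<close>)
    moreover have "0 < m" using in_m[of "[]"] by simp
    ultimately show ?thesis
      using assms(1,2) in_m[OF subsetD[OF assms(3)]] in_m[of "[]"] by (auto simp: is_dfa_def B_def)
  qed
  moreover have "dfa_lang B = L"
  proof -
    have "g (R w) \<in> g ` R ` L \<longleftrightarrow> w \<in> L" if "w \<in> lists \<Sigma>" for w
      using that assms(3) gR sat by (smt (verit) image_iff subsetD)
    moreover have "dfa_lang B = {w \<in> lists \<Sigma>. g (R w) \<in> g ` R ` L}"
      unfolding dfa_lang_def B_def dfa.simps using fold by (metis (lifting))
    ultimately show ?thesis
      using subsetD[OF assms(3)] by (intro set_eqI) (metis (lifting) mem_Collect_eq)
  qed
  ultimately show ?thesis by (intro exI[of _ B]) (auto simp: B_def)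
qed

section \<open>Catenation\<close>

lemma catenation_assoc: "catenation (catenation K L) M = catenation K (catenation L M)"
proof (intro set_eqI iffI)
  fix w assume "w \<in> catenation (catenation K L) M"
  then obtain u v x where "w = (u @ v) @ x" "u \<in> K" "v \<in> L" "x \<in> M"
    by (auto simp: catenation_def)
  then show "w \<in> catenation K (catenation L M)"
    by (force simp: catenation_def)
next
  fix w assume "w \<in> catenation K (catenation L M)"
  then obtain u v x where "w = u @ (v @ x)" "u \<in> K" "v \<in> L" "x \<in> M"
    by (auto simp: catenation_def)
  then show "w \<in> catenation (catenation K L) M"
    unfolding catenation_def by (simp add: append_assoc[symmetric] del: append_assoc) blast
qed

text \<open>\<open>catenation_list\<close> peels factors from the left, whereas the construction
  appends automata on the right.\<close>

lemma catenation_list_snoc: "catenation_list (Ls @ [L]) = catenation (catenation_list Ls) L"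
proof (induction Ls)
  case Nil
  show ?case by (auto simp: catenation_list_def catenation_def)
next
  case (Cons K Ls)
  then show ?case by (simp add: catenation_list_def catenation_assoc)
qed

section \<open>The tuple of reached state sets\<close>

locale dfa_chain =
  fixes k :: nat and A :: "nat \<Rightarrow> ('q, 'a) dfa" and \<Sigma> :: "'a set"
  assumes dfa: "i \<in> {1..k} \<Longrightarrow> is_dfa (A i)"
    and alpha: "i \<in> {1..k} \<Longrightarrow> alphabet (A i) = \<Sigma>"
begin

abbreviation "Q i \<equiv> states (A i)"
abbreviation "F i \<equiv> finals (A i)"
abbreviation "s i \<equiv> start (A i)"
abbreviation "run i \<equiv> foldl (trans_fun (A i)) (s i)"

definition cat_lang :: "nat \<Rightarrow> 'a list set" where
  "cat_lang j = catenation_list (map (\<lambda>i. dfa_lang (A i)) [1..<j+1])"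

text \<open>The value outside \<open>{1..k}\<close> is fixed, so equality of the functions
  \<open>reach u\<close> and \<open>reach v\<close> amounts to equality of the \<open>k\<close>
  relevant sets.\<close>

definition reach :: "'a list \<Rightarrow> nat \<Rightarrow> 'q set" where
  "reach w j = (if j \<in> {1..k} then {run j v | u v. w = u @ v \<and> u \<in> cat_lang (j - 1)} else {})"

lemma reachI: "j \<in> {1..k} \<Longrightarrow> u \<in> cat_lang (j - 1) \<Longrightarrow> run j v \<in> reach (u @ v) j"
  by (auto simp: reach_def)

lemma finite_Q: "i \<in> {1..k} \<Longrightarrow> finite (Q i)"
  and F_subset: "i \<in> {1..k} \<Longrightarrow> F i \<subseteq> Q i"
  and start_Q: "i \<in> {1..k} \<Longrightarrow> s i \<in> Q i"
  using dfa by (auto simp: is_dfa_def)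

lemma run_states:
  assumes "i \<in> {1..k}" "w \<in> lists \<Sigma>"
  shows "run i w \<in> Q i"
  using assms(2)
proof (induction w rule: rev_induct)
  case Nil
  then show ?case using start_Q assms(1) by simp
next
  case (snoc a w)
  then show ?case using dfa[OF assms(1)] alpha[OF assms(1)] by (auto simp: is_dfa_def)
qed

lemma cat_lang_0: "cat_lang 0 = {[]}"
  by (simp add: cat_lang_def catenation_list_def)

lemma cat_lang_Suc: "cat_lang (Suc j) = catenation (cat_lang j) (dfa_lang (A (Suc j)))"
  by (simp add: cat_lang_def catenation_list_snoc)

lemma cat_lang_lists: "j \<le> k \<Longrightarrow> cat_lang j \<subseteq> lists \<Sigma>"
proof (induction j)
  case (Suc j)
  have "dfa_lang (A (Suc j)) \<subseteq> lists \<Sigma>"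
    using alpha[of "Suc j"] Suc.prems by (auto simp: dfa_lang_def)
  then show ?case
    using Suc by (fastforce simp: cat_lang_Suc catenation_def)
qed (simp add: cat_lang_0)

lemma reach_1: "1 \<le> k \<Longrightarrow> reach w 1 = {run 1 w}"
  by (simp add: reach_def cat_lang_0)

lemma reach_subset:
  assumes "w \<in> lists \<Sigma>" "j \<in> {1..k}"
  shows "reach w j \<subseteq> Q j"
proof
  fix q assume "q \<in> reach w j"
  then obtain u v where "w = u @ v" "q = run j v"
    using assms by (auto simp: reach_def)
  then show "q \<in> Q j"
    using run_states[OF assms(2), of v] assms(1) by (simp add: append_in_lists_conv del: in_lists_conv_set)
qed

text \<open>Splitting off the last factor of the catenation yields this for every \<open>j\<close>,
  so the tuple decides membership in all partial catenations. The case \<open>j = k\<close> is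
  acceptance; smaller \<open>j\<close> tell when an initial state is forced.\<close>

lemma reach_meets_finals:
  assumes "w \<in> lists \<Sigma>" "j \<in> {1..k}"
  shows "reach w j \<inter> F j \<noteq> {} \<longleftrightarrow> w \<in> cat_lang j"
proof -
  obtain i where j: "j = Suc i" using assms by (cases j) auto
  have "w \<in> cat_lang j \<longleftrightarrow> (\<exists>u v. w = u @ v \<and> u \<in> cat_lang i \<and> v \<in> lists \<Sigma> \<and> run j v \<in> F j)"
    using alpha[OF assms(2)] unfolding j cat_lang_Suc by (auto simp: catenation_def dfa_lang_def)
  also have "\<dots> \<longleftrightarrow> (\<exists>u v. w = u @ v \<and> u \<in> cat_lang i \<and> run j v \<in> F j)"
    using assms(1) by (metis append_in_lists_conv)
  also have "\<dots> \<longleftrightarrow> reach w j \<inter> F j \<noteq> {}"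
    using assms(2) j by (auto simp: reach_def)
  finally show ?thesis by simp
qed

lemma reach_start:
  assumes "w \<in> cat_lang j" "Suc j \<in> {1..k}"
  shows "s (Suc j) \<in> reach w (Suc j)"
  using reachI[OF assms(2), of w "[]"] assms(1) by simp

text \<open>A prefix in \<open>cat_lang j\<close> itself begins with a word of
  \<open>cat_lang (j - 1)\<close>, whose remaining suffix would give an element of
  \<open>reach w j\<close>.\<close>

lemma reach_empty:
  assumes "j \<in> {1..k}" "reach w j = {}"
  shows "reach w (Suc j) = {}"
proof (rule ccontr)
  assume "reach w (Suc j) \<noteq> {}"
  then obtain u v where uv: "w = u @ v" "u \<in> cat_lang j"
    by (auto simp: reach_def split: if_splits)
  obtain i where j: "j = Suc i" using assms by (cases j) auto
  then obtain u' u'' where "u = u' @ u''" "u' \<in> cat_lang i"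
    using uv(2) by (auto simp: cat_lang_Suc catenation_def)
  then have "run j (u'' @ v) \<in> reach w j"
    using reachI[OF assms(1), of u' "u'' @ v"] uv(1) j by simp
  with assms(2) show False by simp
qed

text \<open>The factorizations with nonempty second part extend those of \<open>w\<close>; the one
  with empty second part contributes the initial state.\<close>

lemma reach_snoc:
  assumes "j \<in> {1..k}"
  shows "reach (w @ [a]) j =
    (\<lambda>q. trans_fun (A j) q a) ` reach w j \<union> (if w @ [a] \<in> cat_lang (j - 1) then {s j} else {})"
    (is "_ = ?rhs")
proof (intro set_eqI iffI)
  fix q assume "q \<in> reach (w @ [a]) j"
  then obtain u v where uv: "w @ [a] = u @ v" "u \<in> cat_lang (j - 1)" "q = run j v"
    using assms by (auto simp: reach_def)
  show "q \<in> ?rhs"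
  proof (cases v rule: rev_cases)
    case Nil
    with uv show ?thesis by simp
  next
    case (snoc v' b)
    with uv have "w = u @ v'" "b = a" by auto
    with uv assms have "run j v' \<in> reach w j" by (auto simp: reach_def)
    then show ?thesis using uv(3) snoc \<open>b = a\<close> by simp
  qed
next
  fix q assume q: "q \<in> ?rhs"
  show "q \<in> reach (w @ [a]) j"
  proof (cases "q \<in> (\<lambda>q. trans_fun (A j) q a) ` reach w j")
    case True
    then obtain u v where "w = u @ v" "u \<in> cat_lang (j - 1)" "q = trans_fun (A j) (run j v) a"
      using assms by (auto simp: reach_def)
    then show ?thesis
      using reachI[OF assms, of u "v @ [a]"] by simp
  next
    case False
    with q have "w @ [a] \<in> cat_lang (j - 1)" "q = s j" by (auto split: if_splits)
    then show ?thesis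
      using reachI[OF assms, of "w @ [a]" "[]"] by simp
  qed
qed

lemma reach_cong:
  assumes "u \<in> lists \<Sigma>" "v \<in> lists \<Sigma>" "a \<in> \<Sigma>" "reach u = reach v"
  shows "reach (u @ [a]) = reach (v @ [a])"
proof
  fix j
  show "reach (u @ [a]) j = reach (v @ [a]) j"
  proof (induction j)
    case (Suc j)
    show ?case
    proof (cases "Suc j \<in> {1..k}")
      case True
      \<comment> \<open>For positive \<open>j\<close> the new entry at \<open>j\<close>, equal by
        induction, decides membership; for \<open>j = 0\<close> both extended words are
        nonempty.\<close>
      have "u @ [a] \<in> cat_lang j \<longleftrightarrow> v @ [a] \<in> cat_lang j"
      proof (cases "j = 0")
        case False
        with True have "j \<in> {1..k}" by auto
        then show ?thesis
          using reach_meets_finals[of _ j] assms Suc by (metis append_in_lists_conv Cons_in_lists_iff lists.Nil)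
      qed (simp add: cat_lang_0)
      then show ?thesis using assms(4) reach_snoc[OF True] by simp
    qed (auto simp: reach_def)
  qed (simp add: reach_def)
qed

section \<open>Counting the admissible tuples\<close>

text \<open>The flag \<open>h\<close> stands for a final state in entry \<open>j - 1\<close>.
  Entries outside \<open>{j..k}\<close> are set to the empty set, so that each tail has a single
  representative.\<close>

definition suffixes :: "nat \<Rightarrow> bool \<Rightarrow> (nat \<Rightarrow> 'q set) set" where
  "suffixes j h = {S. (\<forall>i\<in>{j..k}. S i \<subseteq> Q i) \<and> (\<forall>i. i \<notin> {j..k} \<longrightarrow> S i = {}) \<and>
     (h \<and> j \<le> k \<longrightarrow> s j \<in> S j) \<and>
     (\<forall>i\<in>{j..<k}. (S i = {} \<longrightarrow> S (Suc i) = {}) \<and> (S i \<inter> F i \<noteq> {} \<longrightarrow> s (Suc i) \<in> S (Suc i)))}"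

definition heads :: "nat \<Rightarrow> bool \<Rightarrow> 'q set set" where
  "heads j h = {S \<in> Pow (Q j) - {{}}. h \<longrightarrow> s j \<in> S}"

lemma suffixes_empty:
  assumes "S \<in> suffixes j h" "S j = {}"
  shows "S = (\<lambda>_. {})"
proof
  fix i
  show "S i = {}"
  proof (cases "i \<in> {j..k}")
    case True
    then have "j \<le> i" "i \<le> k" by auto
    then show ?thesis
      using assms by (induction i rule: dec_induct) (auto simp: suffixes_def)
  qed (use assms in \<open>auto simp: suffixes_def\<close>)
qed

text \<open>This is the set-level form of the recursion for \<open>V_count\<close>: either entry
  \<open>j\<close>, and with it the whole tail, is empty, or a nonempty head determines the flag of
  the remaining tail.\<close>

lemma suffixes_step:
  assumes "j \<le> k"
  shows "suffixes j h \<subseteq> (if h then {} else {\<lambda>_. {}}) \<union>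
    (\<Union>U\<in>heads j h. (\<lambda>S. S(j := U)) ` suffixes (Suc j) (U \<inter> F j \<noteq> {}))"
proof
  fix S assume S: "S \<in> suffixes j h"
  show "S \<in> (if h then {} else {\<lambda>_. {}}) \<union>
    (\<Union>U\<in>heads j h. (\<lambda>S. S(j := U)) ` suffixes (Suc j) (U \<inter> F j \<noteq> {}))"
  proof (cases "S j = {}")
    case True
    then have "\<not> h" using S assms by (auto simp: suffixes_def)
    then show ?thesis using suffixes_empty[OF S True] by simp
  next
    case False
    have "S j \<in> heads j h"
      using S False assms by (auto simp: suffixes_def heads_def)
    moreover have "S(j := {}) \<in> suffixes (Suc j) (S j \<inter> F j \<noteq> {})"
      using S assms unfolding suffixes_def by (auto simp: Suc_le_eq)
    moreover have "S = (S(j := {}))(j := S j)" by simp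
    ultimately show ?thesis by blast
  qed
qed

lemma finite_heads: "j \<in> {1..k} \<Longrightarrow> finite (heads j h)"
  using finite_Q by (auto simp: heads_def)

lemma finite_suffixes: "1 \<le> j \<Longrightarrow> finite (suffixes j h)"
proof (induction "Suc k - j" arbitrary: j h)
  case 0
  then have "suffixes j h \<subseteq> {\<lambda>_. {}}" by (auto simp: suffixes_def)
  then show ?case using finite_subset by blast
next
  case (Suc m)
  then have "finite (suffixes (Suc j) h)" for h by simp
  moreover have "j \<le> k" "finite (heads j h)"
    using Suc finite_heads[of j h] by auto
  ultimately show ?case
    by (intro finite_subset[OF suffixes_step]) auto
qed

text \<open>If \<open>s j\<close> is final, sets containing \<open>s j\<close> never avoid \<open>F j\<close>; hence only an
  inequality in the second claim.\<close>

lemma card_heads: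
  assumes "j \<in> {1..k}" "card (Q j) = n j" "card (F j) = f j" "f j < n j"
  shows "int (card (heads j h)) = w_next n f j (of_bool h) 0 + w_next n f j (of_bool h) 1"
    and "int (card {U \<in> heads j h. \<not> U \<inter> F j \<noteq> {}}) \<le> w_next n f j (of_bool h) 0"
proof -
  note fin = finite_Q[OF assms(1)] and sub = F_subset[OF assms(1)] and sQ = start_Q[OF assms(1)]
  have h1: "heads j True = {U \<in> Pow (Q j). s j \<in> U}" and h0: "heads j False = Pow (Q j) - {{}}"
    by (auto simp: heads_def)
  show "int (card (heads j h)) = w_next n f j (of_bool h) 0 + w_next n f j (of_bool h) 1"
  proof (cases h)
    case True
    then show ?thesis
      using card_Pow_containing[OF fin sQ] w_next_1_sum[of f j n, OF assms(4)] assms(2) h1 by simp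
  next
    case False
    then show ?thesis
      using w_next_0_sum[of f j n] fin assms h0 by (simp add: card_Pow of_nat_diff)
  qed
  show "int (card {U \<in> heads j h. \<not> U \<inter> F j \<noteq> {}}) \<le> w_next n f j (of_bool h) 0"
  proof (cases h)
    case True
    then have "{U \<in> heads j h. \<not> U \<inter> F j \<noteq> {}} = {U \<in> Pow (Q j). s j \<in> U \<and> U \<inter> F j = {}}"
      using h1 by auto
    moreover have "int (card {U \<in> Pow (Q j). s j \<in> U \<and> U \<inter> F j = {}}) \<le> int (2 ^ (n j - f j - 1))"
      using card_Pow_containing_avoiding[OF fin sub sQ] assms by (simp only: zle_int)
    ultimately show ?thesis
      using True by (simp add: w_next_def)
  next
    case False
    then show ?thesis
      using card_Pow_avoiding[OF fin sub] assms h0 by (simp add: w_next_def)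
  qed
qed

text \<open>Induction on the number of remaining entries, with \<open>suffixes_step\<close> matched
  against the recursion for \<open>V_count\<close>.\<close>

lemma card_suffixes_le:
  assumes card: "\<And>i. i \<in> {1..k} \<Longrightarrow> card (Q i) = n i \<and> card (F i) = f i \<and> f i < n i"
    and "1 \<le> j"
  shows "int (card (suffixes j h)) \<le> V_count k n f j (of_bool h)"
  using assms(2)
proof (induction "Suc k - j" arbitrary: j h)
  case 0
  then have "suffixes j h \<subseteq> {\<lambda>_. {}}" by (auto simp: suffixes_def)
  then have "card (suffixes j h) \<le> 1" using card_mono[of "{\<lambda>_. {}}" "suffixes j h"] by simp
  moreover have "k < j" using 0 by simp
  ultimately show ?case by (simp add: V_count.simps[of k n f j])
next
  case (Suc m)
  then have j: "j \<in> {1..k}" "j \<le> k" by auto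
  let ?hit = "\<lambda>U. U \<inter> F j \<noteq> {}"
  let ?T = "\<lambda>U. (\<lambda>S. S(j := U)) ` suffixes (Suc j) (?hit U)"
  let ?E = "if h then {} else {\<lambda>_. {}} :: (nat \<Rightarrow> 'q set) set"
  have fin: "finite (suffixes (Suc j) g)" for g by (simp add: finite_suffixes)
  have "card (suffixes j h) \<le> card (?E \<union> (\<Union>U\<in>heads j h. ?T U))"
    using fin finite_heads[OF j(1)] by (intro card_mono suffixes_step[OF j(2)]) auto
  also have "\<dots> \<le> card ?E + (\<Sum>U\<in>heads j h. card (?T U))"
    using card_Un_le[of ?E "\<Union>U\<in>heads j h. ?T U"] card_UN_le[OF finite_heads[OF j(1)], of ?T h] by linarith
  finally have "int (card (suffixes j h)) \<le> int (card ?E) + (\<Sum>U\<in>heads j h. int (card (?T U)))"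
    by (simp only: of_nat_sum[symmetric] of_nat_add[symmetric] zle_int)
  also have "(\<Sum>U\<in>heads j h. int (card (?T U)))
      \<le> (\<Sum>U\<in>heads j h. if ?hit U then V_count k n f (Suc j) 1 else V_count k n f (Suc j) 0)"
  proof (rule sum_mono)
    fix U
    have "int (card (?T U)) \<le> int (card (suffixes (Suc j) (?hit U)))"
      using card_image_le[OF fin] by simp
    also have "\<dots> \<le> V_count k n f (Suc j) (of_bool (?hit U))"
      using Suc by simp
    finally show "int (card (?T U)) \<le> (if ?hit U then V_count k n f (Suc j) 1 else V_count k n f (Suc j) 0)"
      by (cases "?hit U") simp_all
  qed
  \<comment> \<open>The number of heads is exact, but the number avoiding the final states is only
    bounded; \<open>V_count_mono\<close> makes that enough for \<open>sum_if_le\<close>.\<close>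
  also have "\<dots> \<le> w_next n f j (of_bool h) 0 * V_count k n f (Suc j) 0
      + w_next n f j (of_bool h) 1 * V_count k n f (Suc j) 1"
    using card_heads[OF j(1)] card[OF j(1)] finite_heads[OF j(1)]
    by (intro sum_if_le V_count_mono) (auto simp: card)
  also have "int (card ?E) = (if of_bool h = (0::nat) then 1 else 0)" by simp
  finally show ?case
    using j by (subst V_count.simps) (simp add: add.assoc)
qed

text \<open>The first entry is a singleton because the first automaton is started only at the
  beginning of the word; the other entries form a tail from index 2 flagged by whether that state is
  final.\<close>

lemma reach_suffix:
  assumes "w \<in> lists \<Sigma>" "1 \<le> k"
  shows "reach w \<in> (\<Union>q\<in>Q 1. (\<lambda>S. S(1 := {q})) ` suffixes 2 (q \<in> F 1))"
proof -
  have step: "s (Suc i) \<in> reach w (Suc i)" if "reach w i \<inter> F i \<noteq> {}" "i \<in> {1..k}" "Suc i \<le> k" for i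
    using that reach_meets_finals[OF assms(1)] reach_start by simp
  have "(reach w)(1 := {}) \<in> suffixes 2 (run 1 w \<in> F 1)"
    unfolding suffixes_def
  proof (intro CollectI conjI ballI allI impI)
    fix i assume "i \<in> {2..k}"
    then show "((reach w)(1 := {})) i \<subseteq> Q i"
      using reach_subset[OF assms(1), of i] by auto
  next
    fix i assume "i \<notin> {2..k}"
    then show "((reach w)(1 := {})) i = {}" by (auto simp: reach_def)
  next
    assume "run 1 w \<in> F 1 \<and> 2 \<le> k"
    then show "s 2 \<in> ((reach w)(1 := {})) 2"
      using step[of 1] reach_1[of w] by (simp add: numeral_2_eq_2)
  next
    fix i assume i: "i \<in> {2..<k}"
    show "((reach w)(1 := {})) (Suc i) = {}" if "((reach w)(1 := {})) i = {}"
      using that i reach_empty[of i w] by auto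
    show "s (Suc i) \<in> ((reach w)(1 := {})) (Suc i)" if "((reach w)(1 := {})) i \<inter> F i \<noteq> {}"
      using that i step[of i] by auto
  qed
  moreover have "run 1 w \<in> Q 1"
    using run_states assms by simp
  moreover have "reach w = ((reach w)(1 := {}))(1 := {run 1 w})"
    using fun_upd_triv[of "reach w" 1] unfolding reach_1[OF assms(2)] fun_upd_upd by (rule sym)
  ultimately show ?thesis by blast
qed

end

theorem theorem7:
  fixes k :: nat
    and A :: "nat \<Rightarrow> ('q, 'a) dfa"
    and \<Sigma> :: "'a set"
    and n f :: "nat \<Rightarrow> nat"
  assumes "k \<ge> 2"
    and "\<And>i. i \<in> {1..k} \<Longrightarrow> is_dfa (A i)"
    and "\<And>i. i \<in> {1..k} \<Longrightarrow> alphabet (A i) = \<Sigma>"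
    and "\<And>i. i \<in> {1..k} \<Longrightarrow> card (states (A i)) = n i"
    and "\<And>i. i \<in> {1..k} \<Longrightarrow> card (finals (A i)) = f i"
    and "\<And>i. i \<in> {1..k} \<Longrightarrow> 0 < f i \<and> f i < n i"
  shows "\<exists>B :: (nat, 'a) dfa.
           is_dfa B \<and> alphabet B = \<Sigma> \<and>
           int (card (states B)) =
             int (n 1) * 2 ^ (\<Sum>j\<in>{2..k}. n j) - D_term k n - (\<Sum>i\<in>{1..k-1}. E_term k n f i) \<and>
           dfa_lang B = catenation_list (map (\<lambda>i. dfa_lang (A i)) [1..<k+1])"
proof -
  interpret dfa_chain k A \<Sigma> by unfold_locales (use assms in auto)
  have k1: "1 \<in> {1..k}" "k \<in> {1..k}" and lt: "\<And>i. i \<in> {1..k} \<Longrightarrow> f i < n i"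
    using assms(1,6) by auto
  let ?T = "\<lambda>q. (\<lambda>S. S(1 := {q})) ` suffixes 2 (q \<in> finals (A 1))"
  let ?X = "\<Union>q\<in>states (A 1). ?T q"
  \<comment> \<open>By \<open>V_count_2\<close> this is the required number of states.\<close>
  let ?m = "w_first n f 0 * V_count k n f 2 0 + w_first n f 1 * V_count k n f 2 1"
  have fin: "finite (suffixes 2 h)" for h by (simp add: finite_suffixes)
  have finQ: "finite (states (A 1))" using finite_Q k1 by blast
  have "int (card ?X) \<le> (\<Sum>q\<in>states (A 1). int (card (?T q)))"
    using card_UN_le[OF finQ, of ?T] by (simp only: of_nat_sum[symmetric] zle_int)
  also have "\<dots> \<le> (\<Sum>q\<in>states (A 1). if q \<in> finals (A 1) then V_count k n f 2 1 else V_count k n f 2 0)"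
  proof (rule sum_mono)
    fix q
    have "int (card (?T q)) \<le> int (card (suffixes 2 (q \<in> finals (A 1))))"
      using card_image_le[OF fin] by simp
    also have "\<dots> \<le> V_count k n f 2 (of_bool (q \<in> finals (A 1)))"
      using assms(4-6) by (intro card_suffixes_le) auto
    finally show "int (card (?T q)) \<le> (if q \<in> finals (A 1) then V_count k n f 2 1 else V_count k n f 2 0)"
      by auto
  qed
  also have "\<dots> \<le> ?m"
  proof (rule sum_if_le[OF finQ])
    have "{q \<in> states (A 1). q \<notin> finals (A 1)} = states (A 1) - finals (A 1)" by auto
    then show "int (card {q \<in> states (A 1). q \<notin> finals (A 1)}) \<le> w_first n f 0"
      using assms(4-6)[OF k1(1)] F_subset[OF k1(1)] finQ
      by (simp add: w_first_def card_Diff_subset finite_subset of_nat_diff)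
    show "V_count k n f 2 1 \<le> V_count k n f 2 0"
      using lt by (intro V_count_mono) auto
  qed (use assms(4)[OF k1(1)] in \<open>simp add: w_first_def\<close>)
  finally have le: "int (card ?X) \<le> ?m" .
  have "\<exists>B :: (nat, 'a) dfa. is_dfa B \<and> alphabet B = \<Sigma> \<and> card (states B) = nat ?m \<and> dfa_lang B = cat_lang k"
  proof (rule dfa_of_right_congruence)
    show "finite \<Sigma>" "\<Sigma> \<noteq> {}"
      using dfa[OF k1(1)] alpha[OF k1(1)] by (auto simp: is_dfa_def)
    show "cat_lang k \<subseteq> lists \<Sigma>" by (simp add: cat_lang_lists)
    show "finite ?X" using fin finQ by blast
    show "reach ` lists \<Sigma> \<subseteq> ?X" using reach_suffix assms(1) by fastforce
    show "card ?X \<le> nat ?m" using le by simp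
    show "reach (u @ [a]) = reach (v @ [a])"
      if "u \<in> lists \<Sigma>" "v \<in> lists \<Sigma>" "a \<in> \<Sigma>" "reach u = reach v" for u v a
      using that by (rule reach_cong)
    show "v \<in> cat_lang k"
      if "u \<in> lists \<Sigma>" "v \<in> lists \<Sigma>" "reach u = reach v" "u \<in> cat_lang k" for u v
      using that reach_meets_finals[OF _ k1(2)] by metis
  qed
  \<comment> \<open>Nonnegativity makes the conversion \<open>nat ?m\<close> lossless.\<close>
  moreover have "0 \<le> ?m" using le by linarith
  ultimately show ?thesis
    using V_count_2[of k f n] assms(1) lt unfolding cat_lang_def by (metis (no_types, lifting) int_nat_eq)
qed

end
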